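(* Let $n$ be an integer with $n\geq 5$. For every $n$-element lattice $L$, the number of subuniverses of $L$ is $2^n$, or $13\cdot 2^{n-4}$, or $23\cdot 2^{n-5}$, or less than $23\cdot 2^{n-5}$.
   Context: A subuniverse of a lattice $L$ is a subset $X\subseteq L$ closed under the binary join and meet of $L$; the empty set is a subuniverse. *)

theory Defs
  imports Main
begin

definition subuniverse :: "'a::lattice set \<Rightarrow> bool" where
  "subuniverse X \<longleftrightarrow> (\<forall>x\<in>X. \<forall>y\<in>X. sup x y \<in> X \<and> inf x y \<in> X)"

end

theory Submission
  imports Defs
begin

text \<open>
  Call a set \<open>X\<close> defective at an incomparable pair \<open>a\<close>, \<open>b\<close> if it contains both but misses their
  join or their meet. A set is a subuniverse unless it is defective somewhere, and each
  incomparable pair is responsible for exactly \<open>3 * 2 ^ (n - 4) = 6 * 2 ^ (n - 5)\<close> defective sets.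
  So a chain has \<open>2 ^ n\<close> subuniverses, and a lattice with one incomparable pair has
  \<open>13 * 2 ^ (n - 4)\<close>. A second incomparable pair contains an element \<open>e\<close> outside
  \<open>{a, b, sup a b, inf a b}\<close>, because \<open>{a, b}\<close> is the only incomparable pair in this set.
  The sets defective at both pairs are then defective at \<open>a\<close>, \<open>b\<close> and contain \<open>e\<close>;
  there are only \<open>3 * 2 ^ (n - 5)\<close> such sets, so at least \<open>(6 + 6 - 3) * 2 ^ (n - 5)\<close>
  sets are not subuniverses, which leaves at most \<open>23 * 2 ^ (n - 5)\<close>.
\<close>

lemma card_supersets:
  assumes "finite (UNIV :: 'a set)"
  shows "card {X :: 'a set. A \<subseteq> X} = 2 ^ (card (UNIV :: 'a set) - card A)"
proof -
  have "bij_betw (\<lambda>X. X - A) {X. A \<subseteq> X} (Pow (- A))"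
    by (rule bij_betw_byWitness[where f' = "\<lambda>Y. Y \<union> A"]) auto
  then have "card {X. A \<subseteq> X} = card (Pow (- A))"
    by (rule bij_betw_same_card)
  also have "\<dots> = 2 ^ (card (UNIV :: 'a set) - card A)"
    using assms finite_subset[OF subset_UNIV assms]
    by (simp add: card_Pow Compl_eq_Diff_UNIV card_Diff_subset)
  finally show ?thesis .
qed

text \<open>Used twice: with \<open>A\<close> an incomparable pair and \<open>B\<close> its closure
  under join and meet, and again with one further element added to both.\<close>

lemma card_supersets_diff:
  assumes "finite (UNIV :: 'a set)" and "A \<subseteq> B"
  shows "card {X :: 'a set. A \<subseteq> X \<and> \<not> B \<subseteq> X}
    = 2 ^ (card (UNIV :: 'a set) - card A) - 2 ^ (card (UNIV :: 'a set) - card B)"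
proof -
  have "{X. A \<subseteq> X \<and> \<not> B \<subseteq> X} = {X. A \<subseteq> X} - {X. B \<subseteq> X}"
    by auto
  moreover have "{X. B \<subseteq> X} \<subseteq> {X. A \<subseteq> X}" "finite {X. B \<subseteq> X}"
    using assms by (auto simp: Finite_Set.finite_set intro: finite_subset[OF subset_UNIV])
  ultimately show ?thesis
    using assms by (simp add: card_Diff_subset card_supersets)
qed

definition incomparable :: "'a::order \<Rightarrow> 'a \<Rightarrow> bool" where
  "incomparable a b \<longleftrightarrow> \<not> a \<le> b \<and> \<not> b \<le> a"

definition defective :: "'a::lattice \<Rightarrow> 'a \<Rightarrow> 'a set set" where
  "defective a b = {X. {a, b} \<subseteq> X \<and> \<not> {a, b, sup a b, inf a b} \<subseteq> X}"

lemma defective_commute: "defective a b = defective b a"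
  by (auto simp: defective_def sup_commute inf_commute)

text \<open>The join and meet of two comparable elements are those elements themselves, so closure
  can fail only at an incomparable pair.\<close>

lemma not_subuniverse_iff:
  "\<not> subuniverse X \<longleftrightarrow> (\<exists>a b. incomparable a b \<and> X \<in> defective a b)"
proof
  assume "\<not> subuniverse X"
  then obtain a b where "a \<in> X" "b \<in> X" "\<not> (sup a b \<in> X \<and> inf a b \<in> X)"
    by (auto simp: subuniverse_def)
  moreover from this have "incomparable a b"
    unfolding incomparable_def by (metis inf.absorb1 inf.absorb2 sup.absorb1 sup.absorb2)
  ultimately show "\<exists>a b. incomparable a b \<and> X \<in> defective a b"
    by (auto simp: defective_def)
qed (auto simp: subuniverse_def defective_def)

lemma incomparable_distinct:
  fixes a b :: "'a::lattice"
  assumes "incomparable a b"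
  shows "a \<noteq> b" "sup a b \<noteq> a" "sup a b \<noteq> b" "inf a b \<noteq> a" "inf a b \<noteq> b" "sup a b \<noteq> inf a b"
proof -
  have nle: "\<not> a \<le> b" "\<not> b \<le> a"
    using assms by (auto simp: incomparable_def)
  show "a \<noteq> b" using nle by blast
  show "sup a b \<noteq> a" using nle by (metis sup_ge2)
  show "sup a b \<noteq> b" using nle by (metis sup_ge1)
  show "inf a b \<noteq> a" using nle by (metis inf_le2)
  show "inf a b \<noteq> b" using nle by (metis inf_le1)
  \<comment> \<open>Equality would give \<open>a \<le> sup a b = inf a b \<le> b\<close>.\<close>
  show "sup a b \<noteq> inf a b" using nle by (metis inf_le2 order_trans sup_ge1)
qed

text \<open>The four elements are distinct, so the count is \<open>2 ^ (n - 2) - 2 ^ (n - 4)\<close>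
  for a lattice of size \<open>n\<close>.\<close>

lemma card_defective:
  fixes a b :: "'a::lattice"
  assumes "card (UNIV :: 'a set) \<ge> 4" and "incomparable a b"
  shows "card (defective a b) = 3 * 2 ^ (card (UNIV :: 'a set) - 4)"
proof -
  have fin: "finite (UNIV :: 'a set)"
    using assms(1) by (intro card_ge_0_finite) simp
  obtain m where m: "card (UNIV :: 'a set) = m + 4"
    using assms(1) by (metis le_add_diff_inverse2)
  have "card {a, b} = 2" "card {a, b, sup a b, inf a b} = 4"
    using incomparable_distinct[OF assms(2)] by auto
  then show ?thesis
    unfolding defective_def by (subst card_supersets_diff[OF fin]) (auto simp: m)
qed

lemma card_defective_containing:
  fixes a b e :: "'a::lattice"
  assumes "card (UNIV :: 'a set) \<ge> 5" and "incomparable a b"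
    and "e \<notin> {a, b, sup a b, inf a b}"
  shows "card {X \<in> defective a b. e \<in> X} = 3 * 2 ^ (card (UNIV :: 'a set) - 5)"
proof -
  have fin: "finite (UNIV :: 'a set)"
    using assms(1) by (intro card_ge_0_finite) simp
  obtain m where m: "card (UNIV :: 'a set) = m + 5"
    using assms(1) by (metis le_add_diff_inverse2)
  have "card {e, a, b} = 3" "card {e, a, b, sup a b, inf a b} = 5"
    using incomparable_distinct[OF assms(2)] assms(3) by auto
  moreover have "{X \<in> defective a b. e \<in> X}
      = {X. {e, a, b} \<subseteq> X \<and> \<not> {e, a, b, sup a b, inf a b} \<subseteq> X}"
    by (auto simp: defective_def)
  ultimately show ?thesis
    by (simp only:) (subst card_supersets_diff[OF fin], auto simp: m)
qed

lemma second_incomparable_pair_outside: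
  fixes a b c d :: "'a::lattice"
  assumes "incomparable c d" and "{c, d} \<noteq> {a, b}"
  obtains e where "e \<in> {c, d}" "e \<notin> {a, b, sup a b, inf a b}"
proof -
  \<comment> \<open>With the bounds of \<open>a\<close> and \<open>b\<close> by their join and meet,
    this leaves \<open>{a, b}\<close> as the only incomparable pair among the four elements.\<close>
  have "inf a b \<le> sup a b"
    by (rule le_infI1) simp
  then have "\<not> {c, d} \<subseteq> {a, b, sup a b, inf a b}"
    using assms by (auto simp: incomparable_def)
  with that show thesis
    by blast
qed

lemma card_subuniverses:
  assumes "finite (UNIV :: 'a::lattice set)"
  shows "card {X :: 'a set. subuniverse X} + card {X :: 'a set. \<not> subuniverse X}
    = 2 ^ card (UNIV :: 'a set)"
proof -
  have "finite (UNIV :: 'a set set)"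
    using assms by (simp add: Finite_Set.finite_set)
  then have "card {X :: 'a set. subuniverse X} + card {X :: 'a set. \<not> subuniverse X}
      = card ({X :: 'a set. subuniverse X} \<union> {X. \<not> subuniverse X})"
    by (intro card_Un_disjoint[symmetric]) (auto intro: finite_subset[OF subset_UNIV])
  also have "{X :: 'a set. subuniverse X} \<union> {X. \<not> subuniverse X} = Pow UNIV"
    by auto
  also have "card (Pow (UNIV :: 'a set)) = 2 ^ card (UNIV :: 'a set)"
    using assms by (rule card_Pow)
  finally show ?thesis .
qed

theorem corollary1p2:
  fixes n :: nat
  assumes "n \<ge> 5"
    and "card (UNIV :: 'a::lattice set) = n"
  shows "card {X :: 'a set. subuniverse X} = 2 ^ n
       \<or> card {X :: 'a set. subuniverse X} = 13 * 2 ^ (n - 4)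
       \<or> card {X :: 'a set. subuniverse X} = 23 * 2 ^ (n - 5)
       \<or> card {X :: 'a set. subuniverse X} < 23 * 2 ^ (n - 5)"
proof -
  let ?N = "{X :: 'a set. \<not> subuniverse X}"
  \<comment> \<open>This avoids truncated subtraction: all counts below are multiples of
    \<open>2 ^ m\<close>, and \<open>2 ^ (n - 4)\<close> is \<open>2 * 2 ^ m\<close>.\<close>
  obtain m where n: "n = m + 5"
    using assms(1) by (metis le_add_diff_inverse2)
  have fin: "finite (UNIV :: 'a set)"
    using assms by (intro card_ge_0_finite) simp
  have finite_sets: "finite \<X>" for \<X> :: "'a set set"
    using fin by (auto simp: Finite_Set.finite_set intro: finite_subset[OF subset_UNIV])
  have total: "card {X :: 'a set. subuniverse X} + card ?N = 32 * 2 ^ m"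
    using card_subuniverses[OF fin] by (simp add: assms(2) n power_add)
  have defective_card: "card (defective a b) = 6 * 2 ^ m" if "incomparable a b" for a b :: 'a
    using card_defective[OF _ that] by (simp add: assms(2) n)
  consider (chain) "\<And>a b :: 'a. \<not> incomparable a b"
    | (one) a b :: 'a where "incomparable a b"
        "\<And>c d :: 'a. incomparable c d \<Longrightarrow> {c, d} = {a, b}"
    | (two) a b c d :: 'a where "incomparable a b" "incomparable c d" "{c, d} \<noteq> {a, b}"
    by metis
  then show ?thesis
  proof cases
    case chain
    then have "card ?N = 0"
      by (auto simp: not_subuniverse_iff)
    with total have "card {X :: 'a set. subuniverse X} = 2 ^ n"
      by (simp only: n power_add) simp
    then show ?thesis ..
  next
    case one
    \<comment> \<open>Equal doubletons may list the pair in the opposite order, hence the appeal to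
      symmetry.\<close>
    have "defective c d = defective a b" if "incomparable c d" for c d
      using one(2)[OF that] defective_commute by (metis doubleton_eq_iff)
    with one(1) have "?N = defective a b"
      unfolding not_subuniverse_iff by blast
    \<comment> \<open>What remains is \<open>(32 - 6) * 2 ^ m = 13 * 2 ^ (m + 1)\<close>.\<close>
    with total defective_card[OF one(1)] show ?thesis
      by (simp add: n)
  next
    case two
    obtain e where e: "e \<in> {c, d}" "e \<notin> {a, b, sup a b, inf a b}"
      using second_incomparable_pair_outside[OF two(2,3)] .
    have "defective a b \<inter> defective c d \<subseteq> {X \<in> defective a b. e \<in> X}"
      using e(1) by (auto simp: defective_def)
    then have "card (defective a b \<inter> defective c d) \<le> card {X \<in> defective a b. e \<in> X}"
      by (rule card_mono[OF finite_sets])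
    then have "card (defective a b \<inter> defective c d) \<le> 3 * 2 ^ m"
      using card_defective_containing[OF _ two(1) e(2)] by (simp add: assms(2) n)
    moreover have "card (defective a b) + card (defective c d)
        = card (defective a b \<union> defective c d) + card (defective a b \<inter> defective c d)"
      by (rule card_Un_Int[OF finite_sets finite_sets])
    moreover have "card (defective a b \<union> defective c d) \<le> card ?N"
      using two by (intro card_mono[OF finite_sets]) (auto simp: not_subuniverse_iff)
    ultimately have "card {X :: 'a set. subuniverse X} \<le> 23 * 2 ^ m"
      using total defective_card[OF two(1)] defective_card[OF two(2)] by linarith
    \<comment> \<open>Equality and strict inequality give the last two alternatives.\<close>
    then show ?thesis
      by (auto simp: n)
  qed
qed

end
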